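(* Let $\eta$ be a multiplier function and let $m\ge1$ be an integer. The operator $$\mathcal{A}_{2m}^\eta(f;x,y)=\sum_{\nu=0}^{2m}\sum_{j=1}^{2m}\mathcal{R}_{\phi_\nu}(f;\cos\theta_{j,2m})\,T_{j,\nu}^\eta(x,y),$$ $$T_{j,\nu}^\eta(x,y)=\frac{1}{(2m+1)^2}\sum_{k=0}^{2m}\eta\left(\frac km\right)(k+1)\sin((k+1)\theta_{j,2m})\,U_k(\phi_\nu;x,y),$$ preserves polynomials of degree $m$; that is, $\mathcal{A}_{2m}^\eta(f)=f$ whenever $f$ is a polynomial in two variables of total degree at most $m$.
   Context: A multiplier function is a function $\eta\in C^r[0,\infty)$, $r$ a positive integer, with $\eta(t)=1$ for $0\le t\le1$ and $\operatorname{supp}\eta\subset[0,2]$. The Radon projection of a function $f$ on the unit disk $B^2=\{x^2+y^2\le1\}$ is $$\mathcal{R}_\theta(f;t)=\int_{-\sqrt{1-t^2}}^{\sqrt{1-t^2}} f(t\cos\theta - s\sin\theta,\ t\sin\theta+s\cos\theta)\,ds,\quad -1\le t\le 1.$$ $U_k$ is the Chebyshev polynomial of the second kind, $U_k(\cos\theta)=\sin((k+1)\theta)/\sin\theta$, and $U_k(\theta;x,y):=U_k(x\cos\theta+y\sin\theta)$. $\phi_\nu=\frac{2\pi\nu}{2m+1}$ and $\theta_{j,2m}=\frac{j\pi}{2m+1}$. *)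

theory Defs
  imports "HOL-Analysis.Analysis" "HOL-Computational_Algebra.Polynomial"
begin

text \<open>At a boundary point of \<open>S\<close> the derivative is one-sided, because it is taken within \<open>S\<close>.\<close>

fun Cr_on :: "nat \<Rightarrow> real set \<Rightarrow> (real \<Rightarrow> real) \<Rightarrow> bool" where
  "Cr_on 0 S f \<longleftrightarrow> continuous_on S f"
| "Cr_on (Suc r) S f \<longleftrightarrow>
     (\<exists>f'. (\<forall>x\<in>S. (f has_real_derivative f' x) (at x within S)) \<and> Cr_on r S f')"

text \<open>Functions on \<open>[0,\<infinity>)\<close> are represented by functions on all reals whose values at
  negative arguments are irrelevant.\<close>

definition multiplier_function :: "nat \<Rightarrow> (real \<Rightarrow> real) \<Rightarrow> bool" where
  "multiplier_function r \<eta> \<longleftrightarrow>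
     r \<ge> 1 \<and> Cr_on r {0..} \<eta> \<and> (\<forall>t\<in>{0..1}. \<eta> t = 1) \<and>
     closure (support_on {0..} \<eta>) \<subseteq> {0..2}"

definition radon :: "real \<Rightarrow> (real \<Rightarrow> real \<Rightarrow> real) \<Rightarrow> real \<Rightarrow> real" where
  "radon \<theta> f t =
     integral {- sqrt (1 - t\<^sup>2) .. sqrt (1 - t\<^sup>2)}
       (\<lambda>s. f (t * cos \<theta> - s * sin \<theta>) (t * sin \<theta> + s * cos \<theta>))"

definition chebU :: "nat \<Rightarrow> real poly" where
  "chebU k = (THE p. \<forall>\<theta>. sin \<theta> \<noteq> 0 \<longrightarrow>
     poly p (cos \<theta>) = sin (real (k + 1) * \<theta>) / sin \<theta>)"

lemma chebU_unique:
  fixes p q :: "real poly"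
  assumes p: "\<forall>\<theta>. sin \<theta> \<noteq> 0 \<longrightarrow> poly p (cos \<theta>) = g \<theta>"
    and q: "\<forall>\<theta>. sin \<theta> \<noteq> 0 \<longrightarrow> poly q (cos \<theta>) = g \<theta>"
  shows "p = q"
proof (rule ccontr)
  assume "p \<noteq> q"
  then have "finite {x. poly (p - q) x = 0}"
    by (intro poly_roots_finite) simp
  moreover have "{-1<..<1} \<subseteq> {x. poly (p - q) x = 0}"
  proof
    fix x :: real
    assume x: "x \<in> {-1<..<1}"
    then have "sin (arccos x) \<noteq> 0"
      using sin_arccos_nonzero by auto
    then have "poly p (cos (arccos x)) = poly q (cos (arccos x))"
      using p q by auto
    then show "x \<in> {x. poly (p - q) x = 0}"
      using x by (simp add: cos_arccos)
  qed
  ultimately have "finite {-1<..<1::real}"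
    by (rule rev_finite_subset)
  then show False
    using infinite_Ioo[of "-1::real" 1] by simp
qed

fun chebU_rec :: "nat \<Rightarrow> real poly" where
  "chebU_rec 0 = 1"
| "chebU_rec (Suc 0) = [:0, 2:]"
| "chebU_rec (Suc (Suc k)) = [:0, 2:] * chebU_rec (Suc k) - chebU_rec k"

lemma chebU_rec_mult_sin: "poly (chebU_rec k) (cos \<theta>) * sin \<theta> = sin (real (k + 1) * \<theta>)"
proof (induction k rule: chebU_rec.induct)
  case 1
  show ?case by simp
next
  case 2
  show ?case by (simp add: sin_double)
next
  case (3 k)
  have "sin (real (Suc (Suc k) + 1) * \<theta>) + sin (real (k + 1) * \<theta>)
      = 2 * cos \<theta> * sin (real (Suc k + 1) * \<theta>)"
  proof -
    have "real (Suc (Suc k) + 1) * \<theta> = real (Suc k + 1) * \<theta> + \<theta>"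
      "real (k + 1) * \<theta> = real (Suc k + 1) * \<theta> - \<theta>"
      by (simp_all add: algebra_simps)
    then show ?thesis by (simp only: sin_add sin_diff) simp
  qed
  with 3 show ?case by (simp add: algebra_simps)
qed

lemma chebU_eq_rec: "chebU k = chebU_rec k"
  unfolding chebU_def
proof (rule the_equality)
  show *: "\<forall>\<theta>. sin \<theta> \<noteq> 0 \<longrightarrow>
      poly (chebU_rec k) (cos \<theta>) = sin (real (k + 1) * \<theta>) / sin \<theta>"
    using chebU_rec_mult_sin[of k] by (auto simp: field_simps)
  show "p = chebU_rec k" if "\<forall>\<theta>. sin \<theta> \<noteq> 0 \<longrightarrow>
      poly p (cos \<theta>) = sin (real (k + 1) * \<theta>) / sin \<theta>" for p
    using chebU_unique[OF that *] .
qed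

lemma poly_chebU_cos:
  "sin \<theta> \<noteq> 0 \<Longrightarrow> poly (chebU k) (cos \<theta>) = sin (real (k + 1) * \<theta>) / sin \<theta>"
  using chebU_rec_mult_sin[of k \<theta>] by (simp add: chebU_eq_rec field_simps)

definition ridgeU :: "nat \<Rightarrow> real \<Rightarrow> real \<Rightarrow> real \<Rightarrow> real" where
  "ridgeU k \<theta> x y = poly (chebU k) (x * cos \<theta> + y * sin \<theta>)"

definition phi :: "nat \<Rightarrow> nat \<Rightarrow> real" where
  "phi m \<nu> = 2 * pi * real \<nu> / real (2 * m + 1)"

definition theta :: "nat \<Rightarrow> nat \<Rightarrow> real" where
  "theta m j = real j * pi / real (2 * m + 1)"

definition T_eta :: "nat \<Rightarrow> (real \<Rightarrow> real) \<Rightarrow> nat \<Rightarrow> nat \<Rightarrow> real \<Rightarrow> real \<Rightarrow> real" where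
  "T_eta m \<eta> j \<nu> x y =
     1 / (real (2 * m + 1))\<^sup>2 *
     (\<Sum>k=0..2*m. \<eta> (real k / real m) * real (k + 1) * sin (real (k + 1) * theta m j)
        * ridgeU k (phi m \<nu>) x y)"

definition A_eta :: "nat \<Rightarrow> (real \<Rightarrow> real) \<Rightarrow> (real \<Rightarrow> real \<Rightarrow> real) \<Rightarrow> real \<Rightarrow> real \<Rightarrow> real" where
  "A_eta m \<eta> f x y =
     (\<Sum>\<nu>=0..2*m. \<Sum>j=1..2*m. radon (phi m \<nu>) f (cos (theta m j)) * T_eta m \<eta> j \<nu> x y)"

definition bivariate_poly_le :: "nat \<Rightarrow> (real \<Rightarrow> real \<Rightarrow> real) \<Rightarrow> bool" where
  "bivariate_poly_le m f \<longleftrightarrow>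
     (\<exists>c :: nat \<Rightarrow> nat \<Rightarrow> real. \<forall>x y. f x y = (\<Sum>i\<le>m. \<Sum>j\<le>m - i. c i j * x ^ i * y ^ j))"

end

theory Submission
  imports Defs
begin

text \<open>
  By Marr's formula, the Radon projection of the ridge polynomial \<open>U\<^sub>n(\<alpha>; x, y)\<close> in direction
  \<open>\<phi>\<close> at \<open>cos \<psi>\<close> is \<open>2 sin ((n + 1) \<psi>) U\<^sub>n(cos (\<phi> - \<alpha>)) / (n + 1)\<close>. Discrete orthogonality
  of the sines at the nodes \<open>\<theta>\<^sub>j\<close> leaves only the term \<open>k = n\<close> of the operator, where \<open>\<eta> = 1\<close>
  because \<open>n \<le> m\<close>. What remains is an average over the \<open>2m + 1\<close> equispaced angles \<open>\<phi>\<^sub>\<nu>\<close> of a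
  trigonometric polynomial of degree \<open>2n \<le> 2m\<close>; it is a discrete convolution with the kernel
  \<open>U\<^sub>n(cos \<beta>) = \<Sum>\<^bsub>j\<le>n\<^esub> cis ((n - 2j) \<beta>)\<close>, which reproduces \<open>U\<^sub>n(\<alpha>; x, y)\<close>. Since the \<open>U\<^sub>k\<close> with \<open>k \<le> n\<close>
  span the polynomials of degree \<open>n\<close>, the ridge powers \<open>(x cos \<alpha> + y sin \<alpha>)\<^sup>n\<close> are preserved for
  all but finitely many values of \<open>tan \<alpha>\<close>. Dividing by \<open>cos\<^sup>n \<alpha>\<close> and comparing coefficients of
  powers of \<open>tan \<alpha>\<close> shows that every monomial is preserved.
\<close>

subsection \<open>Chebyshev polynomials\<close>

lemma poly_chebU_Suc_Suc:
  "poly (chebU (Suc (Suc k))) t = 2 * t * poly (chebU (Suc k)) t - poly (chebU k) t"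
  by (simp add: chebU_eq_rec algebra_simps)

lemma degree_chebU_le: "degree (chebU k) \<le> k"
  unfolding chebU_eq_rec
proof (induction k rule: chebU_rec.induct)
  case (3 k)
  have "degree ([:0, 2:] * chebU_rec (Suc k)) \<le> Suc (Suc k)"
    using degree_mult_le[of "[:0, 2::real:]" "chebU_rec (Suc k)"] 3 by simp
  then show ?case using 3 by (simp only: chebU_rec.simps) (intro degree_diff_le, auto)
qed auto

lemma coeff_chebU_self: "coeff (chebU k) k = 2 ^ k"
  unfolding chebU_eq_rec
proof (induction k rule: chebU_rec.induct)
  case (3 k)
  have "coeff (chebU_rec k) (Suc (Suc k)) = 0"
    using degree_chebU_le[of k] unfolding chebU_eq_rec by (intro coeff_eq_0) auto
  then show ?case using 3 by simp
qed auto

text \<open>Induction on \<open>n\<close>: as \<open>U_(n+1)\<close> has leading coefficient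
  \<open>2 ^ Suc n\<close>, subtracting a suitable multiple of it kills the top coefficient of
  \<open>p\<close>.\<close>

lemma poly_eq_sum_chebU:
  assumes "degree p \<le> n"
  shows "\<exists>a. \<forall>t. poly p t = (\<Sum>k\<le>n. a k * poly (chebU k) t)"
  using assms
proof (induction n arbitrary: p)
  case 0
  then obtain c where "p = [:c:]" by (auto elim: degree_eq_zeroE)
  then show ?case by (intro exI[of _ "\<lambda>_. c"]) (simp add: chebU_eq_rec)
next
  case (Suc n)
  define b where "b = coeff p (Suc n) / 2 ^ Suc n"
  define q where "q = p - smult b (chebU (Suc n))"
  have "degree q \<le> Suc n"
    unfolding q_def using Suc.prems degree_chebU_le[of "Suc n"]
    by (intro degree_diff_le) (auto intro: order_trans[OF degree_smult_le])
  moreover have "coeff q (Suc n) = 0"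
    by (simp add: q_def b_def coeff_chebU_self)
  ultimately have "degree q \<le> n"
    by (metis le_SucE leading_coeff_0_iff degree_0 le0)
  then obtain a where a: "\<forall>t. poly q t = (\<Sum>k\<le>n. a k * poly (chebU k) t)"
    using Suc.IH by blast
  have "poly p t = (\<Sum>k\<le>Suc n. (a(Suc n := b)) k * poly (chebU k) t)" for t
  proof -
    have "(\<Sum>k\<le>n. (a(Suc n := b)) k * poly (chebU k) t) = poly q t"
      using a by (auto intro!: sum.cong)
    then show ?thesis by (simp add: q_def)
  qed
  then show ?case by blast
qed

section \<open>First-kind Chebyshev polynomials and Marr's formula\<close>

fun chebT :: "nat \<Rightarrow> real poly" where
  "chebT 0 = 1"
| "chebT (Suc 0) = [:0, 1:]"
| "chebT (Suc (Suc k)) = [:0, 2:] * chebT (Suc k) - chebT k"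

lemma poly_chebT_cos: "poly (chebT k) (cos \<theta>) = cos (real k * \<theta>)"
proof (induction k rule: chebT.induct)
  case (3 k)
  have "real (Suc (Suc k)) * \<theta> = real (Suc k) * \<theta> + \<theta>" "real k * \<theta> = real (Suc k) * \<theta> - \<theta>"
    by (simp_all add: algebra_simps)
  then have "cos (real (Suc (Suc k)) * \<theta>) + cos (real k * \<theta>) = 2 * cos \<theta> * cos (real (Suc k) * \<theta>)"
    by (simp only: cos_add cos_diff) simp
  with 3 show ?case by (simp add: algebra_simps)
qed auto

text \<open>Differentiate \<open>T_(k+1)(cos \<theta>) = cos ((k+1) \<theta>)\<close> and divide by
  \<open>- sin \<theta>\<close>; \<open>chebU_unique\<close> turns agreement at cosines into
  equality of polynomials. This supplies the antiderivative of \<open>U_k\<close> for the Radon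
  integral.\<close>

lemma pderiv_chebT: "pderiv (chebT (Suc k)) = smult (real (Suc k)) (chebU k)"
proof (rule chebU_unique; intro allI impI)
  fix \<theta> :: real
  assume s: "sin \<theta> \<noteq> 0"
  have "((\<lambda>x. poly (chebT (Suc k)) (cos x)) has_real_derivative
      poly (pderiv (chebT (Suc k))) (cos \<theta>) * - sin \<theta>) (at \<theta>)"
    by (rule DERIV_chain2[OF poly_DERIV]) (auto intro!: derivative_eq_intros)
  moreover have "((\<lambda>x. cos (real (Suc k) * x)) has_real_derivative
      - sin (real (Suc k) * \<theta>) * real (Suc k)) (at \<theta>)"
    by (auto intro!: derivative_eq_intros)
  ultimately have "poly (pderiv (chebT (Suc k))) (cos \<theta>) * - sin \<theta> = - sin (real (Suc k) * \<theta>) * real (Suc k)"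
    unfolding poly_chebT_cos by (rule DERIV_unique)
  then show "poly (pderiv (chebT (Suc k))) (cos \<theta>) = real (Suc k) * sin (real (Suc k) * \<theta>) / sin \<theta>"
    using s by (simp add: field_simps)
  show "poly (smult (real (Suc k)) (chebU k)) (cos \<theta>) = real (Suc k) * sin (real (Suc k) * \<theta>) / sin \<theta>"
    using s by (simp add: poly_chebU_cos)
qed

text \<open>On the line of integration the argument of \<open>U_n\<close> is affine in
  \<open>s\<close> with slope \<open>- sin \<beta>\<close>, so \<open>F\<close> is an
  antiderivative. At the chord ends \<open>s = sin \<psi>\<close> and
  \<open>s = - sin \<psi>\<close> the argument becomes \<open>cos (\<psi> + \<beta>)\<close> and
  \<open>cos (\<psi> - \<beta>)\<close>, where \<open>T_(n+1)\<close> is explicit.\<close>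

lemma radon_ridgeU:
  assumes "sin \<psi> \<ge> 0" and s: "sin (\<phi> - \<alpha>) \<noteq> 0"
  shows "radon \<phi> (ridgeU n \<alpha>) (cos \<psi>) =
    2 * sin (real (n + 1) * \<psi>) / real (n + 1) * poly (chebU n) (cos (\<phi> - \<alpha>))"
proof -
  define \<beta> where "\<beta> = \<phi> - \<alpha>"
  define F where "F = (\<lambda>s. - poly (chebT (Suc n)) (cos \<psi> * cos \<beta> - s * sin \<beta>) / (real (Suc n) * sin \<beta>))"
  have sb: "sin \<beta> \<noteq> 0" using s by (simp add: \<beta>_def)
  have sq: "sqrt (1 - (cos \<psi>)\<^sup>2) = sin \<psi>"
    using assms(1) by (simp add: sin_squared_eq[symmetric])
  have arg: "(cos \<psi> * cos \<phi> - s * sin \<phi>) * cos \<alpha> + (cos \<psi> * sin \<phi> + s * cos \<phi>) * sin \<alpha>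
      = cos \<psi> * cos \<beta> - s * sin \<beta>" for s
    by (simp add: \<beta>_def cos_diff sin_diff algebra_simps)
  have der: "(F has_real_derivative poly (chebU n) (cos \<psi> * cos \<beta> - s * sin \<beta>)) (at s within S)" for s S
    unfolding F_def
    by (rule derivative_eq_intros DERIV_chain2[OF poly_DERIV] refl)+
      (use sb in \<open>simp_all add: pderiv_chebT del: chebT.simps of_nat_Suc\<close>)
  have "((\<lambda>s. poly (chebU n) (cos \<psi> * cos \<beta> - s * sin \<beta>)) has_integral F (sin \<psi>) - F (- sin \<psi>))
      {- sin \<psi> .. sin \<psi>}"
    using assms(1) der
    by (intro fundamental_theorem_of_calculus) (auto simp: has_real_derivative_iff_has_vector_derivative[symmetric])
  then have "radon \<phi> (ridgeU n \<alpha>) (cos \<psi>) = F (sin \<psi>) - F (- sin \<psi>)"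
    by (simp add: radon_def ridgeU_def sq arg integral_unique)
  also have "\<dots> = (cos (real (Suc n) * (\<psi> - \<beta>)) - cos (real (Suc n) * (\<psi> + \<beta>))) / (real (Suc n) * sin \<beta>)"
  proof -
    have "cos \<psi> * cos \<beta> - sin \<psi> * sin \<beta> = cos (\<psi> + \<beta>)" "cos \<psi> * cos \<beta> - (- sin \<psi>) * sin \<beta> = cos (\<psi> - \<beta>)"
      by (simp_all add: cos_add cos_diff)
    then show ?thesis
      by (simp only: F_def poly_chebT_cos) (simp add: diff_divide_distrib)
  qed
  also have "cos (real (Suc n) * (\<psi> - \<beta>)) - cos (real (Suc n) * (\<psi> + \<beta>))
      = 2 * sin (real (Suc n) * \<psi>) * sin (real (Suc n) * \<beta>)"
    by (simp only: distrib_left right_diff_distrib cos_add cos_diff)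
  finally show ?thesis
    using sb by (simp add: poly_chebU_cos \<beta>_def)
qed

subsection \<open>Discrete orthogonality\<close>

text \<open>With \<open>h\<close> half the angular step, \<open>2 sin h cos (2 j h)\<close> is a
  difference of consecutive sines, so the sum telescopes. The bounds on \<open>c\<close> ensure
  \<open>sin h \<noteq> 0\<close>: \<open>h\<close> is a multiple of \<open>pi\<close> only if
  \<open>2 N\<close> divides \<open>c\<close>.\<close>

lemma sum_cos_nodes:
  fixes c :: int
  assumes "0 < \<bar>c\<bar>" "\<bar>c\<bar> < 2 * int N"
  shows "(\<Sum>j<N. cos (of_int c * (real j * pi / real N))) = (1 - cos (of_int c * pi)) / 2"
proof -
  define h where "h = of_int c * pi / (2 * real N)"
  have N: "N > 0" using assms by (cases N) auto
  have "sin h \<noteq> 0"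
  proof
    assume "sin h = 0"
    then obtain i :: int where i: "h = of_int i * pi" by (auto simp: sin_zero_iff_int2)
    then have "of_int c = (of_int (2 * int N * i) :: real)"
      using N by (simp add: h_def field_simps)
    then have c: "c = 2 * int N * i" by linarith
    then have "i \<noteq> 0" using assms by auto
    then have "\<bar>c\<bar> \<ge> 2 * int N * 1" unfolding c abs_mult by (intro mult_mono) auto
    then show False using assms by simp
  qed
  moreover have "2 * sin h * (\<Sum>j<N. cos (of_int c * (real j * pi / real N))) = (1 - cos (of_int c * pi)) * sin h"
  proof -
    define g where "g = (\<lambda>j::nat. sin ((2 * real j - 1) * h))"
    have "2 * sin h * cos (of_int c * (real j * pi / real N)) = g (Suc j) - g j" for j
    proof -
      have "of_int c * (real j * pi / real N) = 2 * real j * h" using N by (simp add: h_def field_simps)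
      moreover have "(2 * real (Suc j) - 1) * h = 2 * real j * h + h"
        "(2 * real j - 1) * h = 2 * real j * h - h" by (simp_all add: algebra_simps)
      ultimately show ?thesis unfolding g_def by (simp only: sin_add sin_diff) simp
    qed
    then have "2 * sin h * (\<Sum>j<N. cos (of_int c * (real j * pi / real N))) = g N - g 0"
      by (simp only: sum_distrib_left sum_lessThan_telescope)
    also have "(2 * real N - 1) * h = of_int c * pi - h"
      using N by (simp add: h_def field_simps)
    then have "g N = - cos (of_int c * pi) * sin h"
      by (simp only: g_def sin_diff) (simp add: sin_zero_iff_int2)
    finally show ?thesis by (simp add: g_def algebra_simps)
  qed
  moreover have "S = K / 2" if "s \<noteq> 0" "2 * s * S = K * s" for s S K :: real
    using that by (simp add: field_simps)
  ultimately show ?thesis by blast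
qed

text \<open>The product of sines is half a difference of cosines with frequencies
  \<open>a - b\<close> and \<open>a + b\<close>. These have equal parity, so for
  \<open>a \<noteq> b\<close> their two cosine sums agree and cancel; for \<open>a = b\<close> the
  first sum is \<open>2 m + 1\<close> and the second is zero.\<close>

lemma sum_sin_nodes:
  fixes a b :: nat
  assumes "a \<ge> 1" "b \<ge> 1" "a + b < 2 * (2 * m + 1)"
  shows "(\<Sum>j=1..2*m. sin (real a * theta m j) * sin (real b * theta m j))
    = (if a = b then real (2 * m + 1) / 2 else 0)"
proof -
  let ?N = "2 * m + 1"
  let ?C = "\<lambda>c::int. \<Sum>j<?N. cos (of_int c * (real j * pi / real ?N))"
  \<comment> \<open>The added node \<open>j = 0\<close> contributes nothing, since its angle is
    zero.\<close>
  have "{..<?N} = insert 0 {1..2*m}" by auto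
  then have "(\<Sum>j=1..2*m. sin (real a * theta m j) * sin (real b * theta m j))
      = (\<Sum>j<?N. sin (real a * theta m j) * sin (real b * theta m j))"
    by (simp add: theta_def)
  also have "\<dots> = (\<Sum>j<?N. (cos (of_int (int a - int b) * (real j * pi / real ?N))
      - cos (of_int (int a + int b) * (real j * pi / real ?N))) / 2)"
    by (intro sum.cong refl)
      (simp only: sin_times_sin theta_def of_int_diff of_int_add of_int_of_nat_eq left_diff_distrib distrib_right)
  also have "\<dots> = (?C (int a - int b) - ?C (int a + int b)) / 2"
    by (simp only: sum_divide_distrib[symmetric] sum_subtractf)
  also have "?C (int a + int b) = (1 - cos (of_int (int a + int b) * pi)) / 2"
    using assms by (intro sum_cos_nodes) auto
  also have "cos (of_int (int a + int b) * pi) = cos (of_int (int a - int b) * pi)"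
    by (simp add: distrib_right left_diff_distrib cos_add cos_diff)
  also have "?C (int a - int b) = (if a = b then real ?N else (1 - cos (of_int (int a - int b) * pi)) / 2)"
  proof (cases "a = b")
    case False
    then show ?thesis using assms by (simp only: if_False) (intro sum_cos_nodes, auto)
  qed simp
  finally show ?thesis by (simp split: if_splits)
qed

text \<open>For \<open>l \<noteq> 0\<close> this is a geometric sum over powers of a
  \<open>(2 m + 1)\<close>-th root of unity \<open>w\<close>, and \<open>w \<noteq> 1\<close>
  because \<open>2 m + 1\<close> cannot divide a nonzero \<open>l\<close> with modulus at most
  \<open>2 m\<close>.\<close>

lemma sum_cis_phi:
  fixes l :: int
  assumes "\<bar>l\<bar> \<le> 2 * int m"
  shows "(\<Sum>\<nu>=0..2*m. cis (of_int l * phi m \<nu>)) = (if l = 0 then of_nat (2 * m + 1) else 0)"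
proof (cases "l = 0")
  case False
  let ?N = "2 * m + 1"
  define w where "w = cis (of_int l * (2 * pi / real ?N))"
  have "w \<noteq> 1"
  proof
    assume "w = 1"
    then have "cos (of_int l * (2 * pi / real ?N)) = 1"
      unfolding w_def by (metis cis.sel(1) one_complex.sel(1))
    then obtain i :: int where "of_int l * (2 * pi / real ?N) = of_int i * 2 * pi"
      by (auto simp: cos_one_2pi_int)
    then have "2 * pi * of_int l = 2 * pi * (of_int (int ?N * i) :: real)" by (simp add: field_simps)
    then have "of_int l = (of_int (int ?N * i) :: real)" by (simp only: mult_cancel_left) simp
    then have l: "l = int ?N * i" by linarith
    then have "i \<noteq> 0" using False by auto
    then have "\<bar>l\<bar> \<ge> int ?N * 1" unfolding l abs_mult by (intro mult_mono) auto
    then show False using assms by simp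
  qed
  moreover have "w ^ ?N = 1"
  proof -
    have "real ?N * (of_int l * (2 * pi / real ?N)) = 2 * pi * of_int l" by simp
    then have "w ^ ?N = cis (2 * pi * of_int l)" unfolding w_def Complex.DeMoivre by (simp only:)
    then show ?thesis by (simp add: cis_multiple_2pi)
  qed
  ultimately have "(\<Sum>\<nu><?N. w ^ \<nu>) = 0"
    by (simp only: sum_gp_strict if_False) simp
  moreover have "cis (of_int l * phi m \<nu>) = w ^ \<nu>" for \<nu>
    unfolding w_def Complex.DeMoivre phi_def by (rule arg_cong[of _ _ cis]) (simp add: field_simps)
  moreover have "{0..2*m} = {..<?N}" by auto
  ultimately show ?thesis using False by (simp only: if_False)
qed simp

subsection \<open>The reproducing kernel\<close>

definition trig_poly :: "nat \<Rightarrow> (real \<Rightarrow> complex) \<Rightarrow> bool" where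
  "trig_poly n g \<longleftrightarrow> (\<exists>b. \<forall>\<theta>. g \<theta> = (\<Sum>j\<le>n. b j * cis ((real n - 2 * real j) * \<theta>)))"

lemma trig_poly_diff:
  assumes "trig_poly n f" "trig_poly n g"
  shows "trig_poly n (\<lambda>\<theta>. f \<theta> - g \<theta>)"
proof -
  obtain a b where "\<forall>\<theta>. f \<theta> = (\<Sum>j\<le>n. a j * cis ((real n - 2 * real j) * \<theta>))"
    "\<forall>\<theta>. g \<theta> = (\<Sum>j\<le>n. b j * cis ((real n - 2 * real j) * \<theta>))"
    using assms unfolding trig_poly_def by blast
  then show ?thesis
    unfolding trig_poly_def
    by (intro exI[of _ "\<lambda>j. a j - b j"]) (simp add: sum_subtractf left_diff_distrib)
qed

text \<open>Since \<open>n - 2 j + 1 = (n + 1) - 2 j\<close> and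
  \<open>n - 2 j - 1 = (n + 1) - 2 (j + 1)\<close>, the factor \<open>cis \<theta>\<close> keeps the
  coefficient indices and \<open>cis (- \<theta>)\<close> shifts them by one.\<close>

lemma trig_poly_cis_mult:
  assumes "trig_poly n g"
  shows "trig_poly (Suc n) (\<lambda>\<theta>. c * cis \<theta> * g \<theta>)" "trig_poly (Suc n) (\<lambda>\<theta>. c * cis (- \<theta>) * g \<theta>)"
proof -
  obtain b where b: "\<And>\<theta>. g \<theta> = (\<Sum>j\<le>n. b j * cis ((real n - 2 * real j) * \<theta>))"
    using assms unfolding trig_poly_def by blast
  have "c * cis \<theta> * g \<theta> = (\<Sum>j\<le>Suc n. (if j \<le> n then c * b j else 0)
      * cis ((real (Suc n) - 2 * real j) * \<theta>))" for \<theta>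
    unfolding b sum_distrib_left
    by (auto intro!: sum.cong simp: cis_mult algebra_simps)
  then show "trig_poly (Suc n) (\<lambda>\<theta>. c * cis \<theta> * g \<theta>)" unfolding trig_poly_def by (intro exI allI)
  have "c * cis (- \<theta>) * g \<theta> = (\<Sum>j\<le>Suc n. (case j of 0 \<Rightarrow> 0 | Suc i \<Rightarrow> c * b i)
      * cis ((real (Suc n) - 2 * real j) * \<theta>))" for \<theta>
    unfolding b sum_distrib_left sum.atMost_Suc_shift
    by (auto intro!: sum.cong simp: cis_mult algebra_simps)
  then show "trig_poly (Suc n) (\<lambda>\<theta>. c * cis (- \<theta>) * g \<theta>)" unfolding trig_poly_def by (intro exI allI)
qed

lemma trig_poly_add:
  assumes "trig_poly n f" "trig_poly n g"
  shows "trig_poly n (\<lambda>\<theta>. f \<theta> + g \<theta>)"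
proof -
  have "trig_poly n (\<lambda>\<theta>. 0)" unfolding trig_poly_def by (intro exI[of _ "\<lambda>_. 0"]) simp
  then have "trig_poly n (\<lambda>\<theta>. 0 - g \<theta>)" using assms(2) by (rule trig_poly_diff)
  from trig_poly_diff[OF assms(1) this] show ?thesis by simp
qed

text \<open>Follows the three-term recurrence for \<open>U_n\<close>; its factor
  \<open>2 (x cos \<theta> + y sin \<theta>)\<close> is a combination of \<open>cis \<theta>\<close>
  and \<open>cis (- \<theta>)\<close> and raises the degree by one.\<close>

lemma trig_poly_ridgeU: "trig_poly n (\<lambda>\<theta>. of_real (ridgeU n \<theta> x y))"
proof (induction n rule: chebU_rec.induct)
  case 1
  show ?case unfolding trig_poly_def
    by (intro exI[of _ "\<lambda>_. 1"]) (simp add: ridgeU_def chebU_eq_rec)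
next
  have lin: "of_real (2 * (x * cos \<theta> + y * sin \<theta>)) * w
      = Complex x (- y) * cis \<theta> * w + Complex x y * cis (- \<theta>) * w" for \<theta> w
    by (simp add: complex_eq_iff algebra_simps)
  have step: "trig_poly (Suc k) (\<lambda>\<theta>. of_real (2 * (x * cos \<theta> + y * sin \<theta>)) * g \<theta>)"
    if "trig_poly k g" for k g
    unfolding lin using that by (intro trig_poly_add trig_poly_cis_mult)
  {
    case 2
    have "trig_poly 0 (\<lambda>_. 1)" unfolding trig_poly_def by (intro exI[of _ "\<lambda>_. 1"]) simp
    from step[OF this] show ?case by (simp add: ridgeU_def chebU_eq_rec algebra_simps)
  next
    case (3 k)
    \<comment> \<open>Inserting \<open>cis \<theta> * cis (- \<theta>) = 1\<close> lifts
      \<open>U_k\<close> by two degrees without changing it.\<close>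
    have "trig_poly (Suc (Suc k)) (\<lambda>\<theta>. 1 * cis \<theta> * (1 * cis (- \<theta>) * of_real (ridgeU k \<theta> x y)))"
      using 3 by (intro trig_poly_cis_mult)
    then have "trig_poly (Suc (Suc k)) (\<lambda>\<theta>. of_real (ridgeU k \<theta> x y))"
      by (simp add: mult.assoc[symmetric] cis_mult)
    from trig_poly_diff[OF step[OF 3(1)] this] show ?case
      by (simp add: ridgeU_def poly_chebU_Suc_Suc)
  }
qed

text \<open>Multiplication by \<open>cis \<beta> - cis (- \<beta>)\<close>, which is
  \<open>2 \<i> sin \<beta>\<close>, makes the sum telescope.\<close>

lemma chebU_cos_eq_sum_cis:
  assumes "sin \<beta> \<noteq> 0"
  shows "of_real (poly (chebU n) (cos \<beta>)) = (\<Sum>j\<le>n. cis ((real n - 2 * real j) * \<beta>))"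
proof -
  define g where "g = (\<lambda>j::nat. cis ((real n + 1 - 2 * real j) * \<beta>))"
  have two_i_sin: "cis t - cis (- t) = 2 * \<i> * of_real (sin t)" for t
    by (simp add: complex_eq_iff)
  have "(cis \<beta> - cis (- \<beta>)) * cis ((real n - 2 * real j) * \<beta>) = g j - g (Suc j)" for j
    unfolding g_def by (simp add: left_diff_distrib cis_mult algebra_simps)
  then have "(cis \<beta> - cis (- \<beta>)) * (\<Sum>j<Suc n. cis ((real n - 2 * real j) * \<beta>)) = g 0 - g (Suc n)"
    by (simp only: sum_distrib_left sum_lessThan_telescope')
  also have "\<dots> = cis (real (n + 1) * \<beta>) - cis (- (real (n + 1) * \<beta>))"
    by (simp add: g_def algebra_simps)
  finally have "of_real (sin \<beta>) * (\<Sum>j\<le>n. cis ((real n - 2 * real j) * \<beta>))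
      = complex_of_real (sin (real (n + 1) * \<beta>))"
    unfolding two_i_sin lessThan_Suc_atMost by simp
  then show ?thesis
    using assms by (simp add: poly_chebU_cos field_simps)
qed

lemma trig_poly_reproducing:
  assumes "n \<le> m" "trig_poly n g"
  shows "(\<Sum>\<nu>=0..2*m. (\<Sum>i\<le>n. cis ((real n - 2 * real i) * (phi m \<nu> - \<alpha>))) * g (phi m \<nu>))
    = of_nat (2 * m + 1) * g \<alpha>"
proof -
  obtain b where b: "\<And>\<theta>. g \<theta> = (\<Sum>j\<le>n. b j * cis ((real n - 2 * real j) * \<theta>))"
    using assms unfolding trig_poly_def by blast
  \<comment> \<open>Sum of a kernel frequency \<open>n - 2 i\<close> and a frequency
    \<open>n - 2 j\<close> of \<open>g\<close>. Its modulus is at most \<open>2 n \<le> 2 m\<close>,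
    so averaging over the angles keeps only \<open>l i j = 0\<close>, that is
    \<open>i = n - j\<close>.\<close>
  define l where "l = (\<lambda>i j. 2 * (int n - int i - int j))"
  have "(\<Sum>\<nu>=0..2*m. (\<Sum>i\<le>n. cis ((real n - 2 * real i) * (phi m \<nu> - \<alpha>))) * g (phi m \<nu>))
      = (\<Sum>\<nu>=0..2*m. \<Sum>j\<le>n. \<Sum>i\<le>n. b j * cis (- (real n - 2 * real i) * \<alpha>) * cis (of_int (l i j) * phi m \<nu>))"
    unfolding b sum_product
    by (subst sum.swap) (auto intro!: sum.cong simp: cis_mult l_def algebra_simps)
  also have "\<dots> = (\<Sum>j\<le>n. \<Sum>\<nu>=0..2*m. \<Sum>i\<le>n.
      b j * cis (- (real n - 2 * real i) * \<alpha>) * cis (of_int (l i j) * phi m \<nu>))"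
    by (rule sum.swap)
  also have "\<dots> = (\<Sum>j\<le>n. \<Sum>i\<le>n. b j * cis (- (real n - 2 * real i) * \<alpha>) *
      (\<Sum>\<nu>=0..2*m. cis (of_int (l i j) * phi m \<nu>)))"
    unfolding sum_distrib_left by (intro sum.cong refl sum.swap)
  also have "\<dots> = (\<Sum>j\<le>n. \<Sum>i\<le>n. if i = n - j then
      b j * cis (- (real n - 2 * real i) * \<alpha>) * of_nat (2 * m + 1) else 0)"
  proof (intro sum.cong refl)
    fix i j assume ij: "j \<in> {..n}" "i \<in> {..n}"
    then have "\<bar>l i j\<bar> \<le> 2 * int m" "l i j = 0 \<longleftrightarrow> i = n - j"
      using assms(1) by (auto simp: l_def)
    then show "b j * cis (- (real n - 2 * real i) * \<alpha>) * (\<Sum>\<nu>=0..2*m. cis (of_int (l i j) * phi m \<nu>))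
      = (if i = n - j then b j * cis (- (real n - 2 * real i) * \<alpha>) * of_nat (2 * m + 1) else 0)"
      by (simp add: sum_cis_phi)
  qed
  \<comment> \<open>At \<open>i = n - j\<close> the phase factor \<open>- (n - 2 i)\<close> equals
    \<open>n - 2 j\<close>, which rebuilds \<open>g \<alpha>\<close>.\<close>
  also have "\<dots> = (\<Sum>j\<le>n. b j * cis ((real n - 2 * real j) * \<alpha>) * of_nat (2 * m + 1))"
    by (auto intro!: sum.cong simp: of_nat_diff algebra_simps)
  finally show ?thesis by (simp only: b sum_distrib_left mult_ac)
qed

lemma ridgeU_reproducing:
  assumes "n \<le> m" "\<And>\<nu>. \<nu> \<le> 2 * m \<Longrightarrow> sin (phi m \<nu> - \<alpha>) \<noteq> 0"
  shows "(\<Sum>\<nu>=0..2*m. poly (chebU n) (cos (phi m \<nu> - \<alpha>)) * ridgeU n (phi m \<nu>) x y)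
    = real (2 * m + 1) * ridgeU n \<alpha> x y"
proof -
  have "complex_of_real (\<Sum>\<nu>=0..2*m. poly (chebU n) (cos (phi m \<nu> - \<alpha>)) * ridgeU n (phi m \<nu>) x y)
      = complex_of_real (real (2 * m + 1) * ridgeU n \<alpha> x y)"
    using trig_poly_reproducing[OF assms(1) trig_poly_ridgeU[of n x y], of \<alpha>] assms(2)
    by (simp add: chebU_cos_eq_sum_cis)
  then show ?thesis by (simp only: of_real_eq_iff)
qed

subsection \<open>Preservation of polynomials\<close>

lemma A_eta_ridgeU:
  assumes eta: "\<And>t. 0 \<le> t \<Longrightarrow> t \<le> 1 \<Longrightarrow> \<eta> t = 1"
    and m: "m \<ge> 1" and n: "n \<le> m" and s: "\<And>\<nu>. \<nu> \<le> 2 * m \<Longrightarrow> sin (phi m \<nu> - \<alpha>) \<noteq> 0"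
  shows "A_eta m \<eta> (ridgeU n \<alpha>) x y = ridgeU n \<alpha> x y"
proof -
  let ?N = "real (2 * m + 1)"
  define u where "u = (\<lambda>\<nu>. poly (chebU n) (cos (phi m \<nu> - \<alpha>)))"
  define S where "S = (\<lambda>k j. sin (real (k + 1) * theta m j))"
  define W where "W = (\<lambda>\<nu> k. \<eta> (real k / real m) * real (k + 1) * ridgeU k (phi m \<nu>) x y)"
  \<comment> \<open>The bound needed for orthogonality is
    \<open>n + k + 2 \<le> 3 m + 2 < 4 m + 2\<close>, which uses \<open>m \<ge> 1\<close>.\<close>
  have orth: "(\<Sum>j=1..2*m. S n j * S k j) = (if n = k then ?N / 2 else 0)" if "k \<le> 2 * m" for k
    using sum_sin_nodes[of "n + 1" "k + 1" m] that m n by (simp add: S_def)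
  have "radon (phi m \<nu>) (ridgeU n \<alpha>) (cos (theta m j)) = 2 * S n j / real (n + 1) * u \<nu>"
    if "\<nu> \<in> {0..2*m}" "j \<in> {1..2*m}" for \<nu> j
  proof -
    \<comment> \<open>The nodes lie in \<open>[0, pi]\<close>, where the sine is nonnegative, as
      Marr's formula requires.\<close>
    have "real j / ?N * pi \<le> 1 * pi"
      using that by (intro mult_right_mono) auto
    then have "theta m j \<le> pi" by (simp add: theta_def)
    then have "sin (theta m j) \<ge> 0"
      by (intro sin_ge_zero) (auto simp: theta_def)
    then show ?thesis using s that by (simp add: radon_ridgeU u_def S_def)
  qed
  then have "A_eta m \<eta> (ridgeU n \<alpha>) x y = (\<Sum>\<nu>=0..2*m. \<Sum>j=1..2*m.
      2 * S n j / real (n + 1) * u \<nu> * (1 / ?N\<^sup>2 * (\<Sum>k=0..2*m. S k j * W \<nu> k)))"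
    unfolding A_eta_def T_eta_def by (intro sum.cong refl) (simp add: S_def W_def mult_ac)
  also have "\<dots> = (\<Sum>\<nu>=0..2*m. 2 / (real (n + 1) * ?N\<^sup>2) * u \<nu> *
      (\<Sum>k=0..2*m. W \<nu> k * (\<Sum>j=1..2*m. S n j * S k j)))"
    unfolding sum_distrib_left
    by (rule sum.cong[OF refl], rule trans[OF sum.swap]) (simp add: mult_ac)
  also have "\<dots> = (\<Sum>\<nu>=0..2*m. 2 / (real (n + 1) * ?N\<^sup>2) * u \<nu> * (W \<nu> n * (?N / 2)))"
  proof (intro sum.cong refl)
    fix \<nu>
    have "(\<Sum>k=0..2*m. W \<nu> k * (\<Sum>j=1..2*m. S n j * S k j))
        = (\<Sum>k=0..2*m. if n = k then W \<nu> k * (?N / 2) else 0)"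
      by (intro sum.cong refl) (simp only: orth atLeastAtMost_iff, simp)
    then show "2 / (real (n + 1) * ?N\<^sup>2) * u \<nu> * (\<Sum>k=0..2*m. W \<nu> k * (\<Sum>j=1..2*m. S n j * S k j))
        = 2 / (real (n + 1) * ?N\<^sup>2) * u \<nu> * (W \<nu> n * (?N / 2))"
      using n by simp
  qed
  also have "\<dots> = (\<Sum>\<nu>=0..2*m. 1 / ?N * (u \<nu> * ridgeU n (phi m \<nu>) x y))"
  proof -
    have "\<eta> (real n / real m) = 1" using m n by (intro eta) auto
    \<comment> \<open>The factor \<open>n + 1\<close> in \<open>W\<close> cancels the denominator
      from Marr's formula, and \<open>?N / 2\<close> from orthogonality leaves the averaging weight
      \<open>1 / ?N\<close>.\<close>
    then have "2 / (real (n + 1) * ?N\<^sup>2) * u \<nu> * (W \<nu> n * (?N / 2))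
        = 1 / ?N * (u \<nu> * ridgeU n (phi m \<nu>) x y)" for \<nu>
      by (simp add: W_def power2_eq_square del: of_nat_add of_nat_mult of_nat_Suc)
    then show ?thesis by simp
  qed
  also have "\<dots> = ridgeU n \<alpha> x y"
    by (simp only: u_def sum_distrib_left[symmetric] ridgeU_reproducing[OF n s]) simp
  finally show ?thesis .
qed

section \<open>Linearity, and passage from ridge powers to monomials\<close>

lemma radon_sum:
  assumes "finite I" "\<And>i. i \<in> I \<Longrightarrow> continuous_on UNIV (\<lambda>p. f i (fst p) (snd p))"
  shows "radon \<theta> (\<lambda>x y. \<Sum>i\<in>I. c i * f i x y) t = (\<Sum>i\<in>I. c i * radon \<theta> (f i) t)"
proof -
  have "(\<lambda>s. f i (t * cos \<theta> - s * sin \<theta>) (t * sin \<theta> + s * cos \<theta>)) integrable_on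
      {- sqrt (1 - t\<^sup>2) .. sqrt (1 - t\<^sup>2)}" if "i \<in> I" for i
  proof (rule integrable_continuous_real)
    have "continuous_on {- sqrt (1 - t\<^sup>2) .. sqrt (1 - t\<^sup>2)}
        (\<lambda>s. (t * cos \<theta> - s * sin \<theta>, t * sin \<theta> + s * cos \<theta>))"
      by (intro continuous_intros)
    from continuous_on_compose2[OF assms(2)[OF that] this]
    show "continuous_on {- sqrt (1 - t\<^sup>2) .. sqrt (1 - t\<^sup>2)}
        (\<lambda>s. f i (t * cos \<theta> - s * sin \<theta>) (t * sin \<theta> + s * cos \<theta>))" by simp
  qed
  then show ?thesis
    unfolding radon_def using assms(1) by (subst integral_sum) (auto intro: integrable_on_mult_right)
qed

lemma A_eta_sum:
  assumes "finite I" "\<And>i. i \<in> I \<Longrightarrow> continuous_on UNIV (\<lambda>p. f i (fst p) (snd p))"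
  shows "A_eta m \<eta> (\<lambda>x y. \<Sum>i\<in>I. c i * f i x y) x y = (\<Sum>i\<in>I. c i * A_eta m \<eta> (f i) x y)"
proof -
  have "A_eta m \<eta> (\<lambda>x y. \<Sum>i\<in>I. c i * f i x y) x y = (\<Sum>\<nu>=0..2*m. \<Sum>j=1..2*m. \<Sum>i\<in>I.
      c i * (radon (phi m \<nu>) (f i) (cos (theta m j)) * T_eta m \<eta> j \<nu> x y))"
    unfolding A_eta_def by (simp add: radon_sum[OF assms] sum_distrib_right mult.assoc)
  also have "\<dots> = (\<Sum>\<nu>=0..2*m. \<Sum>i\<in>I. \<Sum>j=1..2*m.
      c i * (radon (phi m \<nu>) (f i) (cos (theta m j)) * T_eta m \<eta> j \<nu> x y))"
    by (intro sum.cong refl, rule sum.swap)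
  also have "\<dots> = (\<Sum>i\<in>I. \<Sum>\<nu>=0..2*m. \<Sum>j=1..2*m.
      c i * (radon (phi m \<nu>) (f i) (cos (theta m j)) * T_eta m \<eta> j \<nu> x y))"
    by (rule sum.swap)
  finally show ?thesis by (simp add: A_eta_def sum_distrib_left)
qed

text \<open>Expand \<open>t ^ n\<close> in \<open>U_0, ..., U_n\<close>; each index is at most
  \<open>m\<close>, so every ridge term is preserved.\<close>

lemma A_eta_ridge_power:
  assumes eta: "\<And>t. 0 \<le> t \<Longrightarrow> t \<le> 1 \<Longrightarrow> \<eta> t = 1"
    and m: "m \<ge> 1" and n: "n \<le> m" and s: "\<And>\<nu>. \<nu> \<le> 2 * m \<Longrightarrow> sin (phi m \<nu> - \<alpha>) \<noteq> 0"
  shows "A_eta m \<eta> (\<lambda>x y. (x * cos \<alpha> + y * sin \<alpha>) ^ n) x y = (x * cos \<alpha> + y * sin \<alpha>) ^ n"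
proof -
  have "degree (monom (1::real) n) \<le> n" by (rule degree_monom_le)
  then obtain a where a: "\<forall>t. poly (monom 1 n) t = (\<Sum>k\<le>n. a k * poly (chebU k) t)"
    using poly_eq_sum_chebU by blast
  have eq: "(\<lambda>x y. (x * cos \<alpha> + y * sin \<alpha>) ^ n) = (\<lambda>x y. \<Sum>k\<le>n. a k * ridgeU k \<alpha> x y)"
    using a by (simp add: ridgeU_def poly_monom)
  have "A_eta m \<eta> (\<lambda>x y. \<Sum>k\<le>n. a k * ridgeU k \<alpha> x y) x y = (\<Sum>k\<le>n. a k * A_eta m \<eta> (ridgeU k \<alpha>) x y)"
    by (rule A_eta_sum) (auto simp: ridgeU_def intro!: continuous_intros)
  also have "\<dots> = (\<Sum>k\<le>n. a k * ridgeU k \<alpha> x y)"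
    using n by (intro sum.cong refl) (simp add: A_eta_ridgeU[OF eta m _ s])
  finally show ?thesis using eq[THEN fun_cong, THEN fun_cong, of x y] unfolding eq by simp
qed

lemma A_eta_monomial:
  assumes eta: "\<And>t. 0 \<le> t \<Longrightarrow> t \<le> 1 \<Longrightarrow> \<eta> t = 1" and m: "m \<ge> 1" and ij: "i + j \<le> m"
  shows "A_eta m \<eta> (\<lambda>x y. x ^ i * y ^ j) x y = x ^ i * y ^ j"
proof -
  define n where "n = i + j"
  \<comment> \<open>\<open>d k\<close> is the binomially weighted error of the operator on
    \<open>x ^ (n - k) * y ^ k\<close> at the fixed point \<open>(x, y)\<close>. These errors become
    the coefficients of a polynomial \<open>P\<close> in \<open>u = tan \<alpha>\<close>.\<close>
  define d where "d = (\<lambda>k. real (n choose k) *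
      (A_eta m \<eta> (\<lambda>x y. x ^ (n - k) * y ^ k) x y - x ^ (n - k) * y ^ k))"
  define P where "P = (\<Sum>k\<le>n. monom (d k) k)"
  have root: "poly P u = 0" if u: "u \<notin> (\<lambda>\<nu>. tan (phi m \<nu>)) ` {0..2*m}" for u
  proof -
    define \<alpha> where "\<alpha> = arctan u"
    have ca: "cos \<alpha> \<noteq> 0" and tan: "tan \<alpha> = u"
      by (simp_all add: \<alpha>_def tan_arctan cos_arctan_not_zero)
    have s: "sin (phi m \<nu> - \<alpha>) \<noteq> 0" if "\<nu> \<le> 2 * m" for \<nu>
    proof
      assume "sin (phi m \<nu> - \<alpha>) = 0"
      then have e: "sin (phi m \<nu>) * cos \<alpha> = cos (phi m \<nu>) * sin \<alpha>" by (simp add: sin_diff)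
      \<comment> \<open>Otherwise \<open>sin (phi m \<nu>)\<close> would be 1 or -1, forcing
        \<open>cos \<alpha> = 0\<close>.\<close>
      then have "cos (phi m \<nu>) \<noteq> 0"
        using ca sin_zero_abs_cos_one[of "phi m \<nu>"] by auto
      then have "tan (phi m \<nu>) = u" using e ca tan by (auto simp: tan_def field_simps)
      then show False using u that by auto
    qed
    define e where "e = (\<lambda>k. real (n choose k) * (cos \<alpha>) ^ (n - k) * (sin \<alpha>) ^ k)"
    have expand: "(\<lambda>x y. (x * cos \<alpha> + y * sin \<alpha>) ^ n) = (\<lambda>x y. \<Sum>k\<le>n. e k * (x ^ (n - k) * y ^ k))"
      by (subst add.commute, subst binomial_ring) (simp add: e_def power_mult_distrib mult_ac)
    have "A_eta m \<eta> (\<lambda>x y. \<Sum>k\<le>n. e k * (x ^ (n - k) * y ^ k)) x y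
        = (\<Sum>k\<le>n. e k * A_eta m \<eta> (\<lambda>x y. x ^ (n - k) * y ^ k) x y)"
      by (rule A_eta_sum) (auto intro!: continuous_intros)
    moreover have "A_eta m \<eta> (\<lambda>x y. (x * cos \<alpha> + y * sin \<alpha>) ^ n) x y = (x * cos \<alpha> + y * sin \<alpha>) ^ n"
      using ij by (intro A_eta_ridge_power eta m s) (simp_all add: n_def)
    ultimately have "(\<Sum>k\<le>n. e k * A_eta m \<eta> (\<lambda>x y. x ^ (n - k) * y ^ k) x y) = (\<Sum>k\<le>n. e k * (x ^ (n - k) * y ^ k))"
      using expand[THEN fun_cong, THEN fun_cong, of x y] unfolding expand by simp
    then have "0 = (\<Sum>k\<le>n. e k * (A_eta m \<eta> (\<lambda>x y. x ^ (n - k) * y ^ k) x y - x ^ (n - k) * y ^ k))"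
      by (simp add: right_diff_distrib sum_subtractf)
    \<comment> \<open>Factoring out \<open>cos \<alpha> ^ n\<close> turns each
      \<open>cos \<alpha> ^ (n - k) * sin \<alpha> ^ k\<close> into \<open>u ^ k\<close>.\<close>
    also have "\<dots> = (cos \<alpha>) ^ n * poly P u"
    proof -
      have "(cos \<alpha>) ^ (n - k) * (sin \<alpha>) ^ k = (cos \<alpha>) ^ n * u ^ k" if "k \<le> n" for k
        using that ca by (simp add: tan[symmetric] tan_def power_divide power_diff)
      then show ?thesis
        by (auto simp: P_def poly_sum poly_monom e_def d_def sum_distrib_left mult_ac intro!: sum.cong)
    qed
    finally show ?thesis using ca by simp
  qed
  have "P = 0"
  proof (rule ccontr)
    assume "P \<noteq> 0"
    \<comment> \<open>A nonzero \<open>P\<close> has finitely many roots and only finitely many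
      slopes \<open>u\<close> were excluded, yet together they exhaust the reals.\<close>
    then have "finite ({u. poly P u = 0} \<union> (\<lambda>\<nu>. tan (phi m \<nu>)) ` {0..2*m})"
      by (simp add: poly_roots_finite)
    moreover have "{u. poly P u = 0} \<union> (\<lambda>\<nu>. tan (phi m \<nu>)) ` {0..2*m} = UNIV"
      using root by auto
    ultimately show False using infinite_UNIV_char_0[where ?'a = real] by simp
  qed
  then have "coeff P j = 0" by simp
  then have "d j = 0" by (simp add: P_def coeff_sum n_def)
  then show ?thesis by (simp add: d_def n_def)
qed

theorem theorem4p5:
  fixes \<eta> :: "real \<Rightarrow> real" and r m :: nat and f :: "real \<Rightarrow> real \<Rightarrow> real"
  assumes "multiplier_function r \<eta>"
    and "m \<ge> 1"
    and "bivariate_poly_le m f"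
  shows "\<forall>x y. A_eta m \<eta> f x y = f x y"
proof (intro allI)
  fix x y
  have eta: "\<eta> t = 1" if "0 \<le> t" "t \<le> 1" for t
    using assms(1) that by (simp add: multiplier_function_def)
  obtain c where c: "\<And>x y. f x y = (\<Sum>i\<le>m. \<Sum>j\<le>m - i. c i j * x ^ i * y ^ j)"
    using assms(3) unfolding bivariate_poly_le_def by blast
  \<comment> \<open>One finite index set replaces the double sum so that \<open>A_eta_sum\<close>
    applies; its pairs satisfy \<open>i + j \<le> m\<close>.\<close>
  define I where "I = (SIGMA i:{..m}. {..m - i})"
  have f: "f = (\<lambda>x y. \<Sum>p\<in>I. c (fst p) (snd p) * (x ^ fst p * y ^ snd p))"
    by (simp add: fun_eq_iff c I_def sum.Sigma case_prod_beta mult.assoc)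
  have "A_eta m \<eta> f x y
      = (\<Sum>p\<in>I. c (fst p) (snd p) * A_eta m \<eta> (\<lambda>x y. x ^ fst p * y ^ snd p) x y)"
    unfolding f by (rule A_eta_sum) (auto simp: I_def intro!: continuous_intros)
  also have "\<dots> = f x y"
    unfolding f using assms(2) by (intro sum.cong refl) (auto simp: I_def A_eta_monomial[OF eta])
  finally show "A_eta m \<eta> f x y = f x y" .
qed

end
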